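(* There exists a language family $\mathcal{L}$ such that for any deadline function $D:\mathbb{N}\to\mathbb{N}$ with $D(i)=O(i)$, every generator $\mathcal{A}$ with vanishing hallucination rate satisfies $$\inf_{K\in\mathcal{L}}\ \inf_{E\in\mathcal{E}(K)}\ \liminf_{i\to\infty}\ \mu_i(\mathcal{A}(E),K,D)=0 .$$ Consequently, $\mu_{low}(\mathcal{A},D)=0$ whenever $D(i)=O(i)$ and $\mathcal{A}$ has a vanishing hallucination rate.
   Context: Game. Fix a countably infinite universe $U=(u_1,u_2,\dots)$ with a fixed bijective enumeration. A language is an infinite subset of $U$; its elements are listed in the order inherited from $U$, $K=(k_1,k_2,\dots)$, and $K_i=\{k_1,\dots,k_i\}$. A language family (collection) is a countable collection $\mathcal{L}=(L^1,L^2,\dots)$ of languages with a fixed enumeration. $\mathcal{E}(K)$ is the set of all enumerations $E=(e_1,e_2,\dots)$ of $K$, i.e. surjections $\mathbb{N}\to K$ (repetitions allowed). A generator $\mathcal{A}$ knows $U$ and $\mathcal{L}$ and is given by maps $\mathcal{A}_t:U^t\to U$, $t\ge1$ (which may depend on $\mathcal{L}$); on $E$ it outputs $o_t=\mathcal{A}_t(e_1,\dots,e_t)$, where $o_t$ must differ from all of $o_1,\dots,o_{t-1}$ and $e_1,\dots,e_t$. Write $\mathcal{A}(E)=(o_1,o_2,\dots)$ and $\mathcal{A}(E)_t=\{o_1,\dots,o_t\}$. A generator may be randomized, i.e. a random seed $R$ selects a deterministic generator $\mathcal{A}_R$; for a randomized generator the stated density equalities are understood to hold almost surely over $R$. Hallucination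 rate. $H_{\mathcal{A}}^{\mathcal{L},K,E}(t)=\mathbb{E}\big[\,|\mathcal{A}(E)_t\setminus K|/t\,\big]$, the expectation being over the internal randomness of $\mathcal{A}$. $\mathcal{A}$ has vanishing hallucination rate if for every countable collection $\mathcal{L}$, $\sup_{K\in\mathcal{L}}\sup_{E\in\mathcal{E}(K)}\lim_{t\to\infty}H_{\mathcal{A}}^{\mathcal{L},K,E}(t)=0$. Density. For sequences $S=(s_1,s_2,\dots)$, $R=(r_1,r_2,\dots)$, put $S_n=\{s_1,\dots,s_n\}$ and, for $D:\mathbb{N}\to\mathbb{N}$, $$\mu_i(S,R,D)=\frac1i\sum_{j=1}^i \mathbf{1}\{r_j\in S_{D(j)}\}.$$ The timely lower density is $\mu_{low}(\mathcal{A},D)=\inf_{\mathcal{L}}\inf_{K\in\mathcal{L}}\inf_{E\in\mathcal{E}(K)}\liminf_{i\to\infty}\mu_i(\mathcal{A}(E),K,D)$, with $\mathcal{L}$ ranging over all countable language collections. *)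

theory Defs
  imports "HOL-Probability.Probability" "HOL-Library.Landau_Symbols"
begin

text \<open>
  The universe is the whole type \<open>'u\<close>, enumerated by a bijection \<open>u :: nat \<Rightarrow> 'u\<close>.
  Sequences \<open>s\<^sub>1, s\<^sub>2, \<dots>\<close> are functions on \<open>nat\<close> with \<open>s\<^sub>n\<close> stored at position \<open>n - 1\<close>; times,
  deadlines and the index \<open>i\<close> of the density keep their 1-based meaning.
\<close>

type_synonym 'u family = "nat \<Rightarrow> 'u set"

definition language_family :: "'u family \<Rightarrow> bool" where
  "language_family L \<longleftrightarrow> (\<forall>n. infinite (L n))"

definition listing :: "(nat \<Rightarrow> 'u) \<Rightarrow> 'u set \<Rightarrow> nat \<Rightarrow> 'u" where
  "listing u K n = u (enumerate (u -` K) n)"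

definition enumerations :: "'u set \<Rightarrow> (nat \<Rightarrow> 'u) set" where
  "enumerations K = {E. range E = K}"

definition initial :: "(nat \<Rightarrow> 'u) \<Rightarrow> nat \<Rightarrow> 'u set" where
  "initial S n = S ` {..<n}"

text \<open>
  A deterministic generator maps a family and the list \<open>[e\<^sub>1, \<dots>, e\<^sub>t]\<close> to \<open>o\<^sub>t\<close>, so the map of time \<open>t\<close>
  is its restriction to lists of length \<open>t\<close>; the value on the empty list is never used.
\<close>

type_synonym 'u generator = "'u family \<Rightarrow> 'u list \<Rightarrow> 'u"

definition outputs :: "'u generator \<Rightarrow> 'u family \<Rightarrow> (nat \<Rightarrow> 'u) \<Rightarrow> nat \<Rightarrow> 'u" where
  "outputs A L E n = A L (map E [0..<Suc n])"

definition novel :: "'u generator \<Rightarrow> bool" where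
  "novel A \<longleftrightarrow> (\<forall>L. language_family L \<longrightarrow> (\<forall>K\<in>range L. \<forall>E\<in>enumerations K. \<forall>n.
     outputs A L E n \<notin> initial (outputs A L E) n \<union> initial E (Suc n)))"

text \<open>
  A randomized generator is given by the law of the deterministic generator \<open>A\<^sub>R\<close> selected by its
  seed. Nothing is lost: a seed space \<open>\<Omega>\<close> with a map \<open>R \<mapsto> A\<^sub>R\<close> induces such a law on the range
  of the map (with the finest
  \<open>\<sigma>\<close>-algebra making that map measurable), and almost sure statements under the law pull back to
  \<open>\<Omega>\<close>. A separate type variable for seeds would instead let the family asserted to exist in the
  theorem depend on the seed type. A deterministic generator \<open>A\<close> is the
  point mass \<open>point_measure {A} (\<lambda>_. 1)\<close>.
\<close>

definition randomized_generator :: "'u generator measure \<Rightarrow> bool" where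
  "randomized_generator M \<longleftrightarrow> prob_space M \<and>
     (\<forall>L xs. language_family L \<longrightarrow> (\<lambda>A. A L xs) \<in> measurable M (count_space UNIV)) \<and>
     (\<forall>A\<in>space M. novel A)"

definition hallucination_rate ::
  "'u generator measure \<Rightarrow> 'u family \<Rightarrow> 'u set \<Rightarrow> (nat \<Rightarrow> 'u) \<Rightarrow> nat \<Rightarrow> real" where
  "hallucination_rate M L K E t =
     (\<integral>A. real (card (initial (outputs A L E) t - K)) / real t \<partial>M)"

definition vanishing_hallucination_rate :: "'u generator measure \<Rightarrow> bool" where
  "vanishing_hallucination_rate M \<longleftrightarrow> (\<forall>L. language_family L \<longrightarrow>
     (\<forall>K\<in>range L. \<forall>E\<in>enumerations K. convergent (hallucination_rate M L K E)) \<and>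
     (SUP K\<in>range L. SUP E\<in>enumerations K. ereal (lim (hallucination_rate M L K E))) = 0)"

definition timely_density ::
  "(nat \<Rightarrow> 'u) \<Rightarrow> (nat \<Rightarrow> 'u) \<Rightarrow> (nat \<Rightarrow> nat) \<Rightarrow> nat \<Rightarrow> real" where
  "timely_density S R D i = (\<Sum>j = 1..i. of_bool (R (j - 1) \<in> initial S (D j))) / real i"

definition timely_lower_density ::
  "(nat \<Rightarrow> 'u) \<Rightarrow> 'u generator \<Rightarrow> (nat \<Rightarrow> nat) \<Rightarrow> ereal" where
  "timely_lower_density u A D = (INF L\<in>{L. language_family L}. INF K\<in>range L. INF E\<in>enumerations K.
     liminf (\<lambda>i. ereal (timely_density (outputs A L E) (listing u K) D i)))"

end

theory Submission
  imports Defs "HOL-Real_Asymp.Real_Asymp"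
begin

text \<open>
  Let \<open>K\<^sub>m\<close> consist of \<open>u\<^sub>0, \<dots>, u\<^sub>m\<close> and all \<open>u\<^sub>n\<close> with \<open>n\<close> a square, and take the family
  \<open>UNIV, K\<^sub>0, K\<^sub>1, \<dots>\<close>. The adversary enumerates \<open>K\<^sub>0\<close> until a time \<open>t\<^sub>0\<close> at which the expected
  fraction of outputs outside \<open>K\<^sub>0\<close> is at most \<open>1\<close>, goes on to enumerate \<open>K\<^sub>1\<close> until a time \<open>t\<^sub>1\<close> at
  which the fraction outside \<open>K\<^sub>1\<close> is at most \<open>1/2\<close>, and so on with \<open>2\<^sup>-\<^sup>m\<close>; in the limit it enumerates
  the whole universe. If \<open>D(j) \<le> C j\<close>, then everything that counts towards the density at
  \<open>i = t\<^sub>m div C\<close> has been output by time \<open>t\<^sub>m\<close>, so it lies in \<open>K\<^sub>m\<close>, which has density zero, or is one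
  of the few outputs outside \<open>K\<^sub>m\<close>. The bounds \<open>2\<^sup>-\<^sup>m\<close> are summable, so almost surely the density
  tends to \<open>0\<close> along these \<open>i\<close>.
\<close>

section \<open>Almost sure convergence, lower limits and linear bounds\<close>

text \<open>By monotone convergence the pointwise series has a finite integral, so it is finite
  almost surely and its terms tend to 0. This turns bounds in expectation into almost sure
  ones.\<close>

lemma AE_tendsto_zero_if_summable_integral:
  fixes f :: "nat \<Rightarrow> 'a \<Rightarrow> real"
  assumes int: "\<And>m. integrable M (f m)" and nonneg: "\<And>m x. 0 \<le> f m x"
    and sum: "summable (\<lambda>m. \<integral>x. f m x \<partial>M)"
  shows "AE x in M. (\<lambda>m. f m x) \<longlonglongrightarrow> 0"
proof -
  have meas [measurable]: "f m \<in> borel_measurable M" for m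
    using int by auto
  have "(\<integral>\<^sup>+x. (\<Sum>m. ennreal (f m x)) \<partial>M) = (\<Sum>m. \<integral>\<^sup>+x. ennreal (f m x) \<partial>M)"
    by (rule nn_integral_suminf) measurable
  also have "\<dots> = (\<Sum>m. ennreal (\<integral>x. f m x \<partial>M))"
    using int nonneg by (simp add: nn_integral_eq_integral)
  also have "\<dots> = ennreal (\<Sum>m. \<integral>x. f m x \<partial>M)"
    using sum nonneg by (intro suminf_ennreal2) auto
  finally have "(\<integral>\<^sup>+x. (\<Sum>m. ennreal (f m x)) \<partial>M) \<noteq> \<infinity>"
    by simp
  then have "AE x in M. (\<Sum>m. ennreal (f m x)) \<noteq> \<infinity>"
    by (intro nn_integral_noteq_infinite) auto
  then show ?thesis
    by eventually_elim (use nonneg in \<open>auto intro!: summable_LIMSEQ_zero summable_suminf_not_top\<close>)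
qed

lemma Liminf_le_if_tendsto_along:
  fixes f :: "'a \<Rightarrow> real"
  assumes r: "filterlim r F G" and lim: "((\<lambda>m. f (r m)) \<longlongrightarrow> c) G" and "G \<noteq> bot"
  shows "Liminf F (\<lambda>i. ereal (f i)) \<le> ereal c"
proof (rule ccontr)
  assume "\<not> ?thesis"
  then obtain d where d: "ereal c < ereal d" "ereal d < Liminf F (\<lambda>i. ereal (f i))"
    using ereal_dense2[of "ereal c"] by (metis not_le)
  have "\<forall>\<^sub>F i in F. d < f i"
    using less_LiminfD[OF d(2)] by simp
  then have "\<forall>\<^sub>F m in G. d < f (r m)"
    using r by (auto simp: filterlim_iff)
  then have "d \<le> c"
    by (intro tendsto_lowerbound[OF lim _ \<open>G \<noteq> bot\<close>]) (auto elim: eventually_mono)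
  with d(1) show False by simp
qed

lemma bigo_nat_uniform_bound:
  assumes "(\<lambda>i. real (D i)) \<in> O(\<lambda>i. real i)"
  obtains C where "C \<ge> 1" "\<And>j. j \<ge> 1 \<Longrightarrow> D j \<le> C * j"
proof -
  obtain c where "\<forall>\<^sub>F i in sequentially. norm (real (D i)) \<le> c * norm (real i)"
    using assms by (elim landau_o.bigE)
  then obtain N where N: "\<And>i. i \<ge> N \<Longrightarrow> real (D i) \<le> c * real i"
    by (auto simp: eventually_sequentially)
  \<comment> \<open>The ceiling covers the tail \<open>j \<ge> N\<close>, the sum dominates each of
    the finitely many values before \<open>N\<close>, and the final 1 ensures
    \<open>C \<ge> 1\<close>.\<close>
  define C where "C = nat \<lceil>c\<rceil> + (\<Sum>j<N. D j) + 1"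
  have "D j \<le> C * j" if "j \<ge> 1" for j
  proof (cases "j < N")
    case True
    then have "D j \<le> (\<Sum>j<N. D j)"
      by (intro member_le_sum) auto
    also have "\<dots> \<le> C * 1" by (simp add: C_def)
    also have "\<dots> \<le> C * j" using that by (intro mult_left_mono) auto
    finally show ?thesis .
  next
    case False
    then have "real (D j) \<le> c * real j" using N by simp
    also have "\<dots> \<le> real C * real j"
      unfolding C_def by (intro mult_right_mono) linarith+
    finally show ?thesis by (simp flip: of_nat_mult)
  qed
  then show ?thesis using that[of C] by (simp add: C_def)
qed

section \<open>The sparse languages and their density\<close>

text \<open>The squares alone give an infinite set of density zero. The initial segment makes the
  languages increase to the whole universe without changing that density.\<close>

definition sparse_language :: "(nat \<Rightarrow> 'u) \<Rightarrow> nat \<Rightarrow> 'u set" where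
  "sparse_language u m = u ` ({..m} \<union> range (\<lambda>k. k\<^sup>2))"

definition sparse_family :: "(nat \<Rightarrow> 'u) \<Rightarrow> 'u family" where
  "sparse_family u n = (case n of 0 \<Rightarrow> UNIV | Suc m \<Rightarrow> sparse_language u m)"

lemma UNIV_in_sparse_family: "UNIV \<in> range (sparse_family u)"
  by (rule range_eqI[of _ _ 0]) (simp add: sparse_family_def)

lemma sparse_language_in_sparse_family: "sparse_language u m \<in> range (sparse_family u)"
  by (rule range_eqI[of _ _ "Suc m"]) (simp add: sparse_family_def)

lemma sparse_language_mono: "m \<le> n \<Longrightarrow> sparse_language u m \<subseteq> sparse_language u n"
  by (auto simp: sparse_language_def)

lemma in_sparse_language: "u m \<in> sparse_language u m"
  by (auto simp: sparse_language_def)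

lemma infinite_sparse_language:
  assumes "inj u"
  shows "infinite (sparse_language u m)"
proof -
  have "infinite (range (\<lambda>k::nat. k\<^sup>2))"
    by (rule range_inj_infinite) (auto intro!: injI)
  then have "infinite ({..m} \<union> range (\<lambda>k. k\<^sup>2))" by simp
  then show ?thesis
    using assms unfolding sparse_language_def by (metis finite_imageD inj_on_subset subset_UNIV)
qed

lemma language_family_sparse_family:
  assumes "inj u"
  shows "language_family (sparse_family u)"
proof -
  have "infinite (UNIV :: 'a set)"
    using infinite_sparse_language[OF assms] by (metis finite_subset subset_UNIV)
  then show ?thesis
    using infinite_sparse_language[OF assms]
    by (auto simp: language_family_def sparse_family_def split: nat.split)
qed

lemma listing_UNIV: "listing u UNIV = u"
proof -
  have "enumerate UNIV n = n" for n :: nat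
  proof (induction n)
    case (Suc n)
    then show ?case
      by (auto simp: enumerate_Suc'' intro!: Least_equality)
  qed (simp add: enumerate_0)
  then show ?thesis by (auto simp: listing_def)
qed

text \<open>The initial segment contributes at most \<open>m + 1\<close> positions. A square
  \<open>k\<^sup>2 = j - 1 < i\<close> has \<open>k \<le> sqrt i\<close>, which leaves at most
  \<open>sqrt i + 1\<close> choices of \<open>k\<close>, counting \<open>k = 0\<close>.\<close>

lemma card_sparse_language_le:
  assumes "inj u"
  shows "real (card {j\<in>{1..i}. u (j - 1) \<in> sparse_language u m}) \<le> real m + sqrt (real i) + 2"
proof -
  define q where "q = nat \<lfloor>sqrt (real i)\<rfloor>"
  have "{j\<in>{1..i}. u (j - 1) \<in> sparse_language u m} \<subseteq> {1..Suc m} \<union> (\<lambda>k. Suc (k\<^sup>2)) ` {..q}"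
  proof
    fix j assume j: "j \<in> {j\<in>{1..i}. u (j - 1) \<in> sparse_language u m}"
    then have "j - 1 \<le> m \<or> (\<exists>k. j - 1 = k\<^sup>2)"
      using assms by (auto simp: sparse_language_def inj_image_mem_iff dest: injD)
    moreover have "k \<le> q" if "j - 1 = k\<^sup>2" for k
    proof -
      have "real k \<le> sqrt (real i)"
        using j that by (intro real_le_rsqrt) (auto simp flip: of_nat_power)
      then show ?thesis unfolding q_def by linarith
    qed
    ultimately show "j \<in> {1..Suc m} \<union> (\<lambda>k. Suc (k\<^sup>2)) ` {..q}"
      using j by (force simp: image_iff)
  qed
  then have "card {j\<in>{1..i}. u (j - 1) \<in> sparse_language u m}
      \<le> card ({1..Suc m} \<union> (\<lambda>k. Suc (k\<^sup>2)) ` {..q})"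
    by (intro card_mono) auto
  also have "\<dots> \<le> card {1..Suc m} + card ((\<lambda>k. Suc (k\<^sup>2)) ` {..q})"
    by (rule card_Un_le)
  also have "\<dots> \<le> Suc m + Suc q"
    using card_image_le[of "{..q}" "\<lambda>k. Suc (k\<^sup>2)"] by simp
  finally have "real (card {j\<in>{1..i}. u (j - 1) \<in> sparse_language u m}) \<le> real m + real q + 2"
    by linarith
  then show ?thesis by (simp add: q_def) linarith
qed

section \<open>Bounds on the timely density\<close>

lemma timely_density_nonneg: "0 \<le> timely_density S R D i"
  by (simp add: timely_density_def sum_nonneg)

lemma INF_liminf_timely_density_nonneg:
  "0 \<le> (INF K\<in>\<K>. INF E\<in>enumerations K.
      liminf (\<lambda>i. ereal (timely_density (outputs A L E) (listing u K) D i)))"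
  by (intro INF_greatest Liminf_bounded always_eventually) (simp add: timely_density_nonneg)

text \<open>A counted position has its element in \<open>K\<close>, or among the outputs up to time
  \<open>t\<close> that lie outside \<open>K\<close>. Since \<open>u\<close> is injective, the
  positions of the second kind inject into those outputs. The set \<open>K\<close> need not be the
  target language: the listing here is \<open>u\<close>, that of \<open>UNIV\<close>.\<close>

lemma timely_density_le:
  assumes "inj u" and D: "\<And>j. j \<in> {1..i} \<Longrightarrow> D j \<le> t"
  shows "timely_density S u D i
    \<le> (real (card {j\<in>{1..i}. u (j - 1) \<in> K}) + real (card (initial S t - K))) / real i"
proof -
  let ?A = "{j\<in>{1..i}. u (j - 1) \<in> K}"
    and ?B = "{j\<in>{1..i}. u (j - 1) \<in> initial S t - K}"
    and ?C = "{j\<in>{1..i}. u (j - 1) \<in> initial S (D j)}"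
  have "?C \<subseteq> ?A \<union> ?B"
    using D by (fastforce simp: initial_def)
  then have "card ?C \<le> card (?A \<union> ?B)"
    by (intro card_mono) auto
  also have "\<dots> \<le> card ?A + card ?B"
    by (rule card_Un_le)
  also have "card ?B \<le> card (initial S t - K)"
  proof (rule card_inj_on_le)
    show "inj_on (\<lambda>j. u (j - 1)) ?B"
      using \<open>inj u\<close> by (auto intro!: inj_onI dest!: injD)
  qed (auto simp: initial_def)
  finally have "card ?C \<le> card ?A + card (initial S t - K)" by simp
  moreover have "(\<Sum>j = 1..i. of_bool (u (j - 1) \<in> initial S (D j))) = real (card ?C)"
    by (simp add: of_bool_def sum.If_cases Int_def conj_commute)
  ultimately show ?thesis
    unfolding timely_density_def by (intro divide_right_mono) auto
qed

section \<open>Hallucination rates\<close>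

lemma hallucination_rate_nonneg: "0 \<le> hallucination_rate M L K E t"
  by (simp add: hallucination_rate_def)

text \<open>The generator works online: outputs before position \<open>t\<close> see only the first
  \<open>t\<close> inputs. Hence rates survive a later change of the enumeration.\<close>

lemma initial_outputs_cong:
  assumes "\<And>n. n < t \<Longrightarrow> E n = E' n"
  shows "initial (outputs A L E) t = initial (outputs A L E') t"
proof -
  have "map E [0..<Suc n] = map E' [0..<Suc n]" if "n < t" for n
    using assms that by auto
  then show ?thesis
    by (auto simp: initial_def outputs_def simp del: upt_Suc map_eq_conv intro!: image_cong)
qed

lemma hallucination_rate_cong:
  assumes "\<And>n. n < t \<Longrightarrow> E n = E' n"
  shows "hallucination_rate M L K E t = hallucination_rate M L K E' t"
  unfolding hallucination_rate_def
  using initial_outputs_cong[OF assms] by simp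

text \<open>The zero supremum bounds each limit from above and nonnegativity bounds it from below;
  the convergence clause makes \<open>lim\<close> the actual limit.\<close>

lemma hallucination_rate_tendsto_zero:
  assumes "vanishing_hallucination_rate M" "language_family L" "K \<in> range L" "E \<in> enumerations K"
  shows "hallucination_rate M L K E \<longlonglongrightarrow> 0"
proof -
  let ?h = "hallucination_rate M L"
  have conv: "?h K E \<longlonglongrightarrow> lim (?h K E)"
    using assms by (auto simp: vanishing_hallucination_rate_def convergent_LIMSEQ_iff)
  then have "0 \<le> lim (?h K E)"
    by (rule LIMSEQ_le_const) (simp add: hallucination_rate_nonneg)
  moreover have "ereal (lim (?h K E)) \<le> (SUP K\<in>range L. SUP E\<in>enumerations K. ereal (lim (?h K E)))"
    using assms(3,4) by (intro SUP_upper2[of K] SUP_upper2[of E]) auto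
  then have "lim (?h K E) \<le> 0"
    using assms by (simp add: vanishing_hallucination_rate_def)
  ultimately show ?thesis using conv by simp
qed

text \<open>Without novelty a repeated hallucination would be counted several times on the right.\<close>

lemma card_hallucinations_eq_sum:
  assumes "novel A" "language_family L" "E \<in> enumerations K'" "K' \<in> range L"
  shows "card (initial (outputs A L E) t - K) = (\<Sum>n<t. of_bool (outputs A L E n \<notin> K))"
proof -
  have new: "outputs A L E n \<notin> initial (outputs A L E) n" for n
    using assms by (auto simp: novel_def)
  have "inj (outputs A L E)"
  proof (rule linorder_injI)
    fix m n :: nat assume "m < n"
    then show "outputs A L E m \<noteq> outputs A L E n"
      using new[of n] by (metis imageI initial_def lessThan_iff)
  qed
  then have "card (outputs A L E ` {n. n < t \<and> outputs A L E n \<notin> K})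
      = card {n. n < t \<and> outputs A L E n \<notin> K}"
    by (intro card_image) (auto dest: inj_on_subset)
  moreover have "outputs A L E ` {n. n < t \<and> outputs A L E n \<notin> K} = initial (outputs A L E) t - K"
    by (auto simp: initial_def)
  ultimately show ?thesis
    by (simp add: of_bool_def sum.If_cases Int_def lessThan_def)
qed

text \<open>Novelty turns the cardinality into a finite sum of bounded measurable indicators. The
  enumerated language \<open>K'\<close> and the set \<open>K\<close> are unrelated, so
  hallucinations relative to a sparse language can be measured while \<open>UNIV\<close> is
  enumerated.\<close>

lemma integrable_hallucinations:
  assumes M: "randomized_generator M" and L: "language_family L"
    and E: "E \<in> enumerations K'" "K' \<in> range L"
  shows "integrable M (\<lambda>A. real (card (initial (outputs A L E) t - K)) / real t)"
proof -
  interpret prob_space M using M by (simp add: randomized_generator_def)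
  have [measurable]: "(\<lambda>A. outputs A L E n) \<in> measurable M (count_space UNIV)" for n
    using M L by (simp add: randomized_generator_def outputs_def)
  have "integrable M (\<lambda>A. (\<Sum>n<t. of_bool (outputs A L E n \<notin> K)) / real t)"
  proof (intro integrable_divide Bochner_Integration.integrable_sum integrable_const_bound[where B = 1])
    fix n
    show "(\<lambda>A. of_bool (outputs A L E n \<notin> K) :: real) \<in> borel_measurable M"
      by (rule measurable_compose[of "\<lambda>A. outputs A L E n" _ "count_space UNIV"]) auto
  qed simp
  moreover have "(\<Sum>n<t. of_bool (outputs A L E n \<notin> K)) / real t
      = real (card (initial (outputs A L E) t - K)) / real t" if "A \<in> space M" for A
    using M that by (simp add: randomized_generator_def card_hallucinations_eq_sum[OF _ L E])
  ultimately show ?thesis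
    by (rule Bochner_Integration.integrable_cong[OF refl, THEN iffD1, rotated])
qed

section \<open>The adversary's enumeration\<close>

text \<open>Repetitions are allowed, so after the prefix one may simply list all of \<open>K\<close>
  from the start.\<close>

lemma extend_enumeration:
  fixes K :: "'u set"
  assumes "K \<noteq> {}" "countable K" "range E \<subseteq> K"
  obtains E' where "E' \<in> enumerations K" "\<And>n. n < s \<Longrightarrow> E' n = E n"
proof
  define E' where "E' n = (if n < s then E n else from_nat_into K (n - s))" for n
  have "x \<in> range E'" if x: "x \<in> K" for x
  proof -
    obtain n where "from_nat_into K n = x"
      using from_nat_into_surj[OF assms(2) x] by auto
    then have "E' (n + s) = x" by (simp add: E'_def)
    then show ?thesis by blast
  qed
  moreover have "range E' \<subseteq> K"
    using assms(3) from_nat_into[OF assms(1)] by (auto simp: E'_def)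
  ultimately show "E' \<in> enumerations K" by (auto simp: enumerations_def)
  show "E' n = E n" if "n < s" for n using that by (simp add: E'_def)
qed

lemma adversarial_enumeration:
  assumes "bij u" and van: "vanishing_hallucination_rate M"
  obtains E t where "E \<in> enumerations UNIV" "\<And>m. t m \<ge> (Suc m)\<^sup>2"
    "\<And>m. hallucination_rate M (sparse_family u) (sparse_language u m) E (t m) \<le> (1/2) ^ m"
proof -
  let ?K = "sparse_language u" and ?h = "hallucination_rate M (sparse_family u)"
  have "inj u" using assms(1) by (rule bij_is_inj)
  have cnt: "countable (?K m)" for m
    by (simp add: sparse_language_def)
  have ne: "?K m \<noteq> {}" for m
    using in_sparse_language[of u m] by blast
  \<comment> \<open>In stage \<open>m\<close> the sequence enumerates all of \<open>?K m\<close>, so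
    the rate hypothesis applies, but only its first \<open>t\<close> entries are kept. Having
    \<open>u m\<close> among them makes the limit surjective. The bound
    \<open>(Suc m)\<^sup>2 \<le> t\<close> makes \<open>m\<close> negligible against
    \<open>t\<close>.\<close>
  define P where "P m = (\<lambda>(E, t). E \<in> enumerations (?K m) \<and> (Suc m)\<^sup>2 \<le> t \<and>
      u m \<in> initial E t \<and> ?h (?K m) E t \<le> (1/2) ^ m)" for m
  define Q :: "(nat \<Rightarrow> 'a) \<times> nat \<Rightarrow> (nat \<Rightarrow> 'a) \<times> nat \<Rightarrow> bool"
    where "Q = (\<lambda>(E, t) (E', t'). t < t' \<and> (\<forall>n<t. E' n = E n))"
  \<comment> \<open>Only the range of the previous sequence is constrained, so this also yields the
    first stage, from a dummy sequence with an empty prefix.\<close>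
  have step: "\<exists>y. P m y \<and> Q x y" if "range (fst x) \<subseteq> ?K m" for m x
  proof -
    obtain E s where x: "x = (E, s)" by force
    have "range E \<subseteq> ?K m" using that x by simp
    from extend_enumeration[OF ne cnt this, where s = s]
    obtain E' where E': "E' \<in> enumerations (?K m)" "\<And>n. n < s \<Longrightarrow> E' n = E n"
      by blast
    have "u m \<in> range E'"
      using E'(1) in_sparse_language[of u m] by (simp add: enumerations_def)
    then obtain k where k: "E' k = u m" by (metis rangeE)
    have "?h (?K m) E' \<longlonglongrightarrow> 0"
      using van language_family_sparse_family[OF \<open>inj u\<close>] sparse_language_in_sparse_family E'(1)
      by (rule hallucination_rate_tendsto_zero)
    then have "\<forall>\<^sub>F t in sequentially. ?h (?K m) E' t < (1/2) ^ m"
      by (rule order_tendstoD) simp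
    then have "\<forall>\<^sub>F t in sequentially. ?h (?K m) E' t < (1/2) ^ m \<and> k < t \<and> (Suc m)\<^sup>2 \<le> t \<and> s < t"
      by (intro eventually_conj eventually_gt_at_top eventually_ge_at_top)
    then obtain t where "?h (?K m) E' t < (1/2) ^ m" "k < t" "(Suc m)\<^sup>2 \<le> t" "s < t"
      using eventually_happens by fastforce
    moreover from this have "u m \<in> initial E' t"
      unfolding initial_def using k by (metis imageI lessThan_iff)
    ultimately have "P m (E', t) \<and> Q x (E', t)"
      using E' by (simp add: P_def Q_def x)
    then show ?thesis by blast
  qed
  have "\<exists>f. \<forall>m. P m (f m) \<and> Q (f m) (f (Suc m))"
  proof (rule dependent_nat_choice)
    show "\<exists>x. P 0 x"
      using step[of "(\<lambda>_. u 0, 0)" 0] in_sparse_language[of u 0] by auto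
    show "\<exists>y. P (Suc m) y \<and> Q x y" if "P m x" for m x
      using that sparse_language_mono[of m "Suc m" u]
      by (intro step) (auto simp: P_def enumerations_def)
  qed
  then obtain f where f: "\<And>m. P m (f m)" "\<And>m. Q (f m) (f (Suc m))" by blast
  define F t where "F m = fst (f m)" and "t m = snd (f m)" for m
  have P: "F m \<in> enumerations (?K m)" "(Suc m)\<^sup>2 \<le> t m" "u m \<in> initial (F m) (t m)"
    "?h (?K m) (F m) (t m) \<le> (1/2) ^ m" for m
    using f(1)[of m] by (auto simp: P_def F_def t_def split: prod.splits)
  have Q: "t m < t (Suc m)" "\<And>n. n < t m \<Longrightarrow> F (Suc m) n = F m n" for m
    using f(2)[of m] by (auto simp: Q_def F_def t_def split: prod.splits)
  have "strict_mono t" using Q(1) by (simp add: strict_mono_Suc_iff)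
  have agree: "F m' n = F m n" if "m \<le> m'" "n < t m" for m m' n
    using that
  proof (induction rule: dec_induct)
    case (step k)
    then have "n < t k" using \<open>strict_mono t\<close> by (meson less_le_trans strict_mono_less_eq)
    then show ?case using Q(2) step by simp
  qed simp
  \<comment> \<open>The diagonal is well chosen: \<open>n < (Suc n)\<^sup>2 \<le> t n\<close>, so
    entry \<open>n\<close> no longer changes from stage \<open>n\<close> on.\<close>
  define E where "E n = F n n" for n
  have E: "E n = F m n" if "n < t m" for m n
  proof -
    have "n < (Suc n)\<^sup>2" by (simp add: power2_eq_square)
    then have "n < t n" using P(2)[of n] by linarith
    then show ?thesis
      using agree[of m n n] agree[of n m n] that by (cases "m \<le> n") (auto simp: E_def)
  qed
  show ?thesis
  proof
    have "u m \<in> range E" for m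
    proof -
      have "initial (F m) (t m) \<subseteq> range E"
        by (auto simp: initial_def E[symmetric])
      then show ?thesis using P(3) by blast
    qed
    then have "range u \<subseteq> range E" by blast
    then show "E \<in> enumerations UNIV"
      unfolding enumerations_def bij_is_surj[OF assms(1)] by (simp add: top.extremum_unique)
    show "(Suc m)\<^sup>2 \<le> t m" for m by (rule P)
    show "?h (?K m) E (t m) \<le> (1/2) ^ m" for m
      using P(4)[of m] hallucination_rate_cong[of "t m" E "F m"] E by simp
  qed
qed

section \<open>Vanishing density along a subsequence\<close>

lemma liminf_timely_density_zero:
  assumes "inj u" and D: "(\<lambda>i. real (D i)) \<in> O(\<lambda>i. real i)"
    and t: "\<And>m. (Suc m)\<^sup>2 \<le> t m"
    and lim: "(\<lambda>m. real (card (initial S (t m) - sparse_language u m)) / real (t m)) \<longlonglongrightarrow> 0"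
  shows "liminf (\<lambda>i. ereal (timely_density S u D i)) \<le> 0"
proof -
  obtain C where C: "C \<ge> 1" "\<And>j. j \<ge> 1 \<Longrightarrow> D j \<le> C * j"
    using bigo_nat_uniform_bound[OF D] by blast
  \<comment> \<open>For \<open>j \<le> i m\<close> the deadline satisfies
    \<open>D j \<le> C * j \<le> t m\<close>, so no output after time \<open>t m\<close>
    counts.\<close>
  define i where "i m = t m div C" for m
  define h where "h m = real (card (initial S (t m) - sparse_language u m)) / real (t m)" for m
  have tpos: "t m > 0" for m
    using t[of m] by (metis gr0I le_zero_eq nat.distinct(1) power_eq_0_iff)
  have tm: "real (Suc m) ^ 2 \<le> real (t m)" for m
    using t[of m] by (metis of_nat_le_iff of_nat_power)
  have "filterlim (\<lambda>m. real (Suc m) ^ 2) at_top sequentially"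
    by real_asymp
  then have t_top: "filterlim (\<lambda>m. real (t m)) at_top sequentially"
    by (rule filterlim_at_top_mono) (intro always_eventually allI tm)
  \<comment> \<open>Rounding down loses less than \<open>C\<close>, and \<open>i m \<ge> 1\<close>
    once \<open>C \<le> t m\<close>. So replacing the denominator \<open>i m\<close> by
    \<open>t m\<close> costs at most a factor \<open>2 * C\<close>.\<close>
  have ti: "real (t m) \<le> 2 * real C * real (i m)" if "C \<le> t m" for m
  proof -
    have "1 \<le> i m" using that C(1) by (simp add: i_def div_greater_zero_iff Suc_leI)
    then have "C \<le> C * i m" by simp
    moreover have "t m < C * i m + C"
      unfolding i_def using C(1) by (metis add.commute dividend_less_times_div less_eq_Suc_le One_nat_def)
    ultimately have "t m \<le> 2 * C * i m" by linarith
    then show ?thesis by (metis of_nat_le_iff of_nat_mult of_nat_numeral)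
  qed
  have large: "\<forall>\<^sub>F m in sequentially. C \<le> t m"
    using t_top by (auto simp: filterlim_at_top dest!: spec[of _ "real C"])
  \<comment> \<open>The three terms come from the initial segment, the squares and the
    hallucinations. The quadratic lower bound on \<open>t m\<close> controls the first.\<close>
  have bound: "timely_density S u D (i m)
      \<le> 2 * real C * ((real m + 2) / real (Suc m) ^ 2 + 1 / sqrt (real (t m)) + h m)" if "C \<le> t m" for m
  proof -
    have ipos: "1 \<le> i m" using that C(1) by (simp add: i_def div_greater_zero_iff Suc_leI)
    have it: "i m \<le> t m" by (simp add: i_def)
    have "D j \<le> t m" if "j \<in> {1..i m}" for j
    proof -
      have "D j \<le> C * j" using C(2) that by simp
      also have "\<dots> \<le> C * i m" using that by simp
      also have "\<dots> \<le> t m" by (simp add: i_def)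
      finally show ?thesis .
    qed
    then have "timely_density S u D (i m)
        \<le> (real (card {j\<in>{1..i m}. u (j - 1) \<in> sparse_language u m})
            + real (card (initial S (t m) - sparse_language u m))) / real (i m)"
      by (rule timely_density_le[OF \<open>inj u\<close>])
    also have "\<dots> \<le> (real m + 2 + sqrt (real (t m)) + h m * real (t m)) / real (i m)"
    proof (intro divide_right_mono add_mono)
      have "real (card {j\<in>{1..i m}. u (j - 1) \<in> sparse_language u m}) \<le> real m + sqrt (real (i m)) + 2"
        by (rule card_sparse_language_le[OF \<open>inj u\<close>])
      also have "sqrt (real (i m)) \<le> sqrt (real (t m))" using it by simp
      finally show "real (card {j\<in>{1..i m}. u (j - 1) \<in> sparse_language u m})
          \<le> real m + 2 + sqrt (real (t m))" by simp
    qed (use tpos[of m] in \<open>auto simp: h_def\<close>)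
    also have "\<dots> \<le> (real m + 2 + sqrt (real (t m)) + h m * real (t m)) / (real (t m) / (2 * real C))"
    proof (rule divide_left_mono)
      show "real (t m) / (2 * real C) \<le> real (i m)"
        using ti[OF that] C(1) by (simp add: field_simps)
    qed (use ipos tpos[of m] C(1) in \<open>auto simp: h_def\<close>)
    also have "\<dots> = 2 * real C * ((real m + 2) / real (t m) + 1 / sqrt (real (t m)) + h m)"
    proof -
      have "sqrt (real (t m)) / real (t m) = 1 / sqrt (real (t m))"
        using tpos[of m] by (simp add: real_div_sqrt field_simps)
      moreover have "(a + b + c * T) / (T / d) = d * (a / T + b / T + c)" if "T > 0" for a b c d T :: real
        using that by (simp add: field_simps)
      ultimately show ?thesis using tpos[of m] by simp
    qed
    also have "\<dots> \<le> 2 * real C * ((real m + 2) / real (Suc m) ^ 2 + 1 / sqrt (real (t m)) + h m)"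
      using tm[of m] tpos[of m] by (intro mult_left_mono add_mono divide_left_mono) auto
    finally show ?thesis .
  qed
  have i_top: "filterlim i at_top sequentially"
    unfolding filterlim_at_top
  proof
    fix N
    show "\<forall>\<^sub>F m in sequentially. N \<le> i m"
      using t_top[unfolded filterlim_at_top, rule_format, of "real (N * C)"]
      by eventually_elim (use C(1) in \<open>simp add: i_def less_eq_div_iff_mult_less_eq del: of_nat_mult\<close>)
  qed
  have "(\<lambda>m. timely_density S u D (i m)) \<longlonglongrightarrow> 0"
  proof (rule tendsto_sandwich[OF _ _ tendsto_const])
    show "\<forall>\<^sub>F m in sequentially. 0 \<le> timely_density S u D (i m)"
      by (simp add: timely_density_nonneg)
    show "\<forall>\<^sub>F m in sequentially. timely_density S u D (i m)
        \<le> 2 * real C * ((real m + 2) / real (Suc m) ^ 2 + 1 / sqrt (real (t m)) + h m)"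
      using large by eventually_elim (rule bound)
    have "(\<lambda>m. (real m + 2) / real (Suc m) ^ 2) \<longlonglongrightarrow> 0"
      by real_asymp
    moreover have "((\<lambda>x::real. 1 / sqrt x) \<longlongrightarrow> 0) at_top"
      by real_asymp
    then have "(\<lambda>m. 1 / sqrt (real (t m))) \<longlonglongrightarrow> 0"
      by (rule filterlim_compose) (rule t_top)
    moreover have "h \<longlonglongrightarrow> 0"
      using lim by (simp add: h_def[abs_def])
    ultimately have "(\<lambda>m. 2 * real C * ((real m + 2) / real (Suc m) ^ 2 + 1 / sqrt (real (t m)) + h m))
        \<longlonglongrightarrow> 2 * real C * (0 + 0 + 0)"
      by (intro tendsto_intros)
    then show "(\<lambda>m. 2 * real C * ((real m + 2) / real (Suc m) ^ 2 + 1 / sqrt (real (t m)) + h m))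
        \<longlonglongrightarrow> 0" by simp
  qed
  then show ?thesis
    using Liminf_le_if_tendsto_along[OF i_top] by (simp add: zero_ereal_def)
qed

section \<open>Almost sure conclusion\<close>

text \<open>The adversary depends only on expected rates, not on the seed. One enumeration
  \<open>E\<close> of \<open>UNIV\<close> therefore serves almost every \<open>A\<close>, and the
  infimum is bounded by its value there.\<close>

lemma AE_INF_liminf_timely_density_zero:
  assumes u: "bij u" and D: "(\<lambda>i. real (D i)) \<in> O(\<lambda>i. real i)"
    and M: "randomized_generator M" and van: "vanishing_hallucination_rate M"
  shows "AE A in M. (INF K\<in>range (sparse_family u). INF E\<in>enumerations K.
    liminf (\<lambda>i. ereal (timely_density (outputs A (sparse_family u) E) (listing u K) D i))) = 0"
proof -
  let ?L = "sparse_family u"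
  have "inj u" using u by (rule bij_is_inj)
  obtain E t where E: "E \<in> enumerations UNIV" and t: "\<And>m. (Suc m)\<^sup>2 \<le> t m"
    and rate: "\<And>m. hallucination_rate M ?L (sparse_language u m) E (t m) \<le> (1/2) ^ m"
    using adversarial_enumeration[OF u van] by blast
  have "AE A in M. (\<lambda>m. real (card (initial (outputs A ?L E) (t m) - sparse_language u m)) / real (t m))
      \<longlonglongrightarrow> 0"
  proof (rule AE_tendsto_zero_if_summable_integral)
    show "integrable M (\<lambda>A. real (card (initial (outputs A ?L E) (t m) - sparse_language u m)) / real (t m))"
      for m
      using M language_family_sparse_family[OF \<open>inj u\<close>] E UNIV_in_sparse_family
      by (rule integrable_hallucinations)
    have "summable (\<lambda>m. hallucination_rate M ?L (sparse_language u m) E (t m))"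
    proof (rule summable_comparison_test')
      show "summable (\<lambda>m. (1/2 :: real) ^ m)" by (rule summable_geometric) simp
    qed (simp add: hallucination_rate_nonneg rate)
    then show "summable (\<lambda>m. \<integral>A. real (card (initial (outputs A ?L E) (t m) - sparse_language u m))
        / real (t m) \<partial>M)"
      by (simp add: hallucination_rate_def)
  qed simp
  then show ?thesis
  proof eventually_elim
    case (elim A)
    let ?d = "\<lambda>K E. liminf (\<lambda>i. ereal (timely_density (outputs A ?L E) (listing u K) D i))"
    have "?d UNIV E \<le> 0"
      unfolding listing_UNIV using \<open>inj u\<close> D t elim by (rule liminf_timely_density_zero)
    then have "(INF K\<in>range ?L. INF E\<in>enumerations K. ?d K E) \<le> 0"
      using E by (intro INF_lower2[OF UNIV_in_sparse_family] INF_lower2[of E])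
    then show ?case
      using INF_liminf_timely_density_nonneg by (rule antisym)
  qed
qed

theorem theorem2:
  fixes u :: "nat \<Rightarrow> 'u"
  assumes "bij u"
  shows "(\<exists>L :: 'u family. language_family L \<and>
           (\<forall>D :: nat \<Rightarrow> nat. (\<lambda>i. real (D i)) \<in> O(\<lambda>i. real i) \<longrightarrow>
             (\<forall>M :: 'u generator measure.
               randomized_generator M \<longrightarrow> vanishing_hallucination_rate M \<longrightarrow>
               (AE A in M. (INF K\<in>range L. INF E\<in>enumerations K.
                  liminf (\<lambda>i. ereal (timely_density (outputs A L E) (listing u K) D i))) = 0)))) \<and>
         (\<forall>(D :: nat \<Rightarrow> nat) (M :: 'u generator measure).
           (\<lambda>i. real (D i)) \<in> O(\<lambda>i. real i) \<longrightarrow>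
           randomized_generator M \<longrightarrow> vanishing_hallucination_rate M \<longrightarrow>
           (AE A in M. timely_lower_density u A D = 0))"
proof (intro conjI exI[of _ "sparse_family u"] allI impI)
  show L: "language_family (sparse_family u)"
    using assms by (intro language_family_sparse_family bij_is_inj)
  fix D :: "nat \<Rightarrow> nat" and M :: "'u generator measure"
  assume *: "(\<lambda>i. real (D i)) \<in> O(\<lambda>i. real i)" "randomized_generator M"
    "vanishing_hallucination_rate M"
  show ae: "AE A in M. (INF K\<in>range (sparse_family u). INF E\<in>enumerations K.
      liminf (\<lambda>i. ereal (timely_density (outputs A (sparse_family u) E) (listing u K) D i))) = 0"
    using assms * by (rule AE_INF_liminf_timely_density_zero)
  \<comment> \<open>The infimum over all families is at most its value at
    \<open>sparse_family u\<close>, so the same null set of seeds suffices.\<close>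
  show "AE A in M. timely_lower_density u A D = 0"
    using ae
  proof eventually_elim
    case (elim A)
    have "timely_lower_density u A D \<le> 0"
      unfolding timely_lower_density_def using L elim
      by (intro INF_lower2[of "sparse_family u"]) auto
    moreover have "0 \<le> timely_lower_density u A D"
      unfolding timely_lower_density_def by (intro INF_greatest INF_liminf_timely_density_nonneg)
    ultimately show ?case by (rule antisym)
  qed
qed

end
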